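(* Let $N, d\ge 1$ be integers and let $2\le p\le\infty$, with conjugate exponent $p'$. Let $S\subset\mathbb{Z}_N^d$ and let $f:\mathbb{Z}_N^d\to\mathbb{C}$ be a function such that $\operatorname{supp}\widehat f\subset S$. Then $$\|f\|_{L^{\infty}(\mathbb{Z}_N^d)}\le N^{-\frac d2}\cdot\|f\|_{L^p(\mathbb{Z}_N^d)}\cdot\|\widehat{\mathbf{1}_S}\|_{L^{p'}(\mathbb{Z}_N^d)}.$$
   Context: $\mathbb{Z}_N^d$ is the $d$-fold product of the cyclic group $\mathbb{Z}_N=\mathbb{Z}/N\mathbb{Z}$. For $f:\mathbb{Z}_N^d\to\mathbb{C}$ the Fourier transform $\widehat f:\mathbb{Z}_N^d\to\mathbb{C}$ is $\widehat f(m)=N^{-d/2}\sum_{x\in\mathbb{Z}_N^d} f(x)e^{-2\pi i\, x\cdot m/N}$, where $x\cdot m=\sum_{j=1}^d x_jm_j$. Norms (of functions and of their Fourier transforms) are with respect to counting measure: $\|f\|_{L^p(\mathbb{Z}_N^d)}=\left(\sum_{x\in\mathbb{Z}_N^d}|f(x)|^p\right)^{1/p}$ for $1\le p<\infty$ and $\|f\|_{L^\infty(\mathbb{Z}_N^d)}=\max_{x\in\mathbb{Z}_N^d}|f(x)|$. The conjugate exponent satisfies $\frac1p+\frac1{p'}=1$ (so $p'=1$ when $p=\infty$). $\mathbf{1}_S$ is the characteristic function of $S$, and $\operatorname{supp}$ denotes the set of points where a function is nonzero. *)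

theory Defs
  imports "HOL-Analysis.Analysis" "HOL-Number_Theory.Residues"
begin

text \<open>
  Points of \<open>\<int>\<^sub>N\<^sup>d\<close> are extensional functions on the index set \<open>{1..d}\<close> with values in the
  representatives \<open>{0..N - 1}\<close>. Functions on \<open>\<int>\<^sub>N\<^sup>d\<close> are total HOL functions; only
  their values on this set are ever used.
\<close>

definition ZNd :: "nat \<Rightarrow> nat \<Rightarrow> (nat \<Rightarrow> int) set" where
  "ZNd N d = {1..d} \<rightarrow>\<^sub>E carrier (residue_ring (int N))"

text \<open>
  The dot product is formed in \<open>\<int>\<close> from representatives; the character below depends
  only on its residue modulo \<open>N\<close>.
\<close>

definition dot :: "nat \<Rightarrow> (nat \<Rightarrow> int) \<Rightarrow> (nat \<Rightarrow> int) \<Rightarrow> int" where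
  "dot d x m = (\<Sum>j = 1..d. x j * m j)"

definition fourier :: "nat \<Rightarrow> nat \<Rightarrow> ((nat \<Rightarrow> int) \<Rightarrow> complex) \<Rightarrow> (nat \<Rightarrow> int) \<Rightarrow> complex" where
  "fourier N d f m =
     of_real (real N powr (- (real d / 2))) *
     (\<Sum>x\<in>ZNd N d. f x * exp (- 2 * of_real pi * \<i> * of_int (dot d x m) / of_nat N))"

definition supp :: "nat \<Rightarrow> nat \<Rightarrow> ((nat \<Rightarrow> int) \<Rightarrow> complex) \<Rightarrow> (nat \<Rightarrow> int) set" where
  "supp N d f = {x \<in> ZNd N d. f x \<noteq> 0}"

text \<open>The norm with respect to counting measure, intended for exponents \<open>1 \<le> p \<le> \<infinity>\<close>.\<close>

definition Lp_norm :: "nat \<Rightarrow> nat \<Rightarrow> ennreal \<Rightarrow> ((nat \<Rightarrow> int) \<Rightarrow> complex) \<Rightarrow> real" where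
  "Lp_norm N d p f =
     (if p = \<infinity> then Max ((\<lambda>x. cmod (f x)) ` ZNd N d)
      else (\<Sum>x\<in>ZNd N d. cmod (f x) powr enn2real p) powr (1 / enn2real p))"

end

theory Submission
  imports Defs
begin

text \<open>
  Write \<open>F g\<close> for the Fourier transform of \<open>g\<close>. Since \<open>F f = 1\<^sub>S \<cdot> F f\<close>, Fourier inversion yields
  the reproducing identity \<open>f x = N\<^bsup>-d/2\<^esup> \<Sum>\<^sub>y f y \<cdot> F 1\<^sub>S (y - x)\<close>. Hoelder's inequality bounds
  the sum, and the \<open>p'\<close>-norm of \<open>y \<mapsto> F 1\<^sub>S (y - x)\<close> does not depend on \<open>x\<close>.
\<close>

section \<open>Hoelder's inequality\<close>

text \<open>Scaling both families to norm 1 and applying Young's inequality termwise bounds the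
  scaled sum by \<open>1 / p + 1 / q = 1\<close>.\<close>

lemma sum_Holder_inequality:
  fixes a b :: "'a \<Rightarrow> real" and p q :: real
  assumes "finite A" and pq: "p > 1" "q > 1" "1 / p + 1 / q = 1"
    and a: "\<And>x. x \<in> A \<Longrightarrow> 0 \<le> a x" and b: "\<And>x. x \<in> A \<Longrightarrow> 0 \<le> b x"
  shows "(\<Sum>x\<in>A. a x * b x) \<le> (\<Sum>x\<in>A. a x powr p) powr (1 / p) * (\<Sum>x\<in>A. b x powr q) powr (1 / q)"
proof -
  define u where "u = (\<Sum>x\<in>A. a x powr p)"
  define v where "v = (\<Sum>x\<in>A. b x powr q)"
  show ?thesis
  \<comment> \<open>A vanishing norm forces that family to be zero on \<open>A\<close>; otherwise
    division by the norms is legitimate.\<close>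
  proof (cases "u = 0 \<or> v = 0")
    case True
    then have "(\<Sum>x\<in>A. a x * b x) = 0"
      using assms(1) by (intro sum.neutral) (auto simp: u_def v_def sum_nonneg_eq_0_iff)
    then show ?thesis by simp
  next
    case False
    have pos: "u > 0" "v > 0"
      using False by (auto simp: u_def v_def less_le sum_nonneg)
    define s where "s = u powr (1 / p)"
    define t where "t = v powr (1 / q)"
    have st: "s > 0" "t > 0" "s powr p = u" "t powr q = v"
      using pos pq by (auto simp: s_def t_def powr_powr)
    have "(\<Sum>x\<in>A. (a x / s) * (b x / t))
        \<le> (\<Sum>x\<in>A. (a x / s) powr p / p + (b x / t) powr q / q)"
      using a b st by (intro sum_mono Youngs_inequality pq) auto
    also have "\<dots> = (\<Sum>x\<in>A. a x powr p / u / p + b x powr q / v / q)"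
      using a b st by (intro sum.cong) (auto simp: powr_divide)
    also have "\<dots> = u / u / p + v / v / q"
      by (simp only: sum.distrib u_def v_def flip: sum_divide_distrib)
    also have "\<dots> = 1" using pos pq by simp
    finally have "(\<Sum>x\<in>A. a x * b x) / (s * t) \<le> 1"
      by (simp add: sum_divide_distrib)
    then show ?thesis
      using st by (simp add: divide_le_eq s_def t_def u_def v_def)
  qed
qed

lemma ZNd_eq: "ZNd N d = {1..d} \<rightarrow>\<^sub>E {0..int N - 1}"
  by (simp add: ZNd_def residue_ring_def)

lemma finite_ZNd [simp]: "finite (ZNd N d)"
  unfolding ZNd_eq by (rule finite_PiE) auto

lemma cmod_le_Max_ZNd: "x \<in> ZNd N d \<Longrightarrow> cmod (f x) \<le> Max ((\<lambda>x. cmod (f x)) ` ZNd N d)"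
  by (rule Max_ge) auto

text \<open>At the endpoints one factor is bounded by its maximum and the other is summed; for two
  finite exponents the claim reduces to the real version.\<close>

lemma Lp_norm_Holder:
  assumes "1 / p + 1 / q = (1 :: ennreal)"
  shows "(\<Sum>x\<in>ZNd N d. cmod (f x) * cmod (g x)) \<le> Lp_norm N d p f * Lp_norm N d q g"
proof -
  \<comment> \<open>In \<open>ennreal\<close>, \<open>1 / \<infinity> = 0\<close>, so only
    \<open>1 / s = 1\<close> remains.\<close>
  have top_1: "r = \<infinity> \<Longrightarrow> 1 / r + 1 / s = 1 \<Longrightarrow> s = 1" for r s :: ennreal
    by (simp add: divide_eq_1_ennreal)
  consider "p = \<infinity>" "q = 1" | "q = \<infinity>" "p = 1" | "p \<noteq> \<infinity>" "q \<noteq> \<infinity>"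
    using top_1[of p q] top_1[of q p] assms by (metis add.commute)
  then show ?thesis
  proof cases
    case 1
    then show ?thesis
      by (auto simp: Lp_norm_def sum_distrib_left sum_nonneg
          intro!: sum_mono mult_right_mono cmod_le_Max_ZNd)
  next
    case 2
    then show ?thesis
      by (auto simp: Lp_norm_def sum_distrib_right sum_nonneg
          intro!: sum_mono mult_left_mono cmod_le_Max_ZNd)
  next
    case 3
    \<comment> \<open>In \<open>ennreal\<close>, \<open>1 / 0 = \<infinity>\<close>, so a zero
      exponent would make the sum of reciprocals infinite.\<close>
    have "p \<noteq> 0" "q \<noteq> 0"
      using assms by (auto simp: ennreal_divide_zero)
    with 3 obtain r s where rs: "p = ennreal r" "q = ennreal s" "r > 0" "s > 0"
      by (cases p; cases q) (auto simp: less_le)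
    have "ennreal (1 / r + 1 / s) = ennreal 1"
      using assms rs by (simp add: divide_ennreal flip: ennreal_1)
    then have eq: "1 / r + 1 / s = 1"
      using rs by (subst (asm) ennreal_inj) auto
    then have "1 / r < 1" "1 / s < 1"
      using rs by (smt (verit) zero_less_divide_1_iff)+
    then have "r > 1" "s > 1" using rs by auto
    then have "(\<Sum>x\<in>ZNd N d. cmod (f x) * cmod (g x))
        \<le> (\<Sum>x\<in>ZNd N d. cmod (f x) powr r) powr (1 / r) * (\<Sum>x\<in>ZNd N d. cmod (g x) powr s) powr (1 / s)"
      using eq by (intro sum_Holder_inequality) auto
    then show ?thesis
      using rs by (simp add: Lp_norm_def)
  qed
qed

section \<open>Characters and their orthogonality\<close>

text \<open>The kernel of the transform, minus sign included, as a character of the integers. It can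
  thus be evaluated at unreduced dot products and their differences.\<close>

definition zchar :: "nat \<Rightarrow> int \<Rightarrow> complex" where
  "zchar N k = exp (- 2 * of_real pi * \<i> * of_int k / of_nat N)"

lemma zchar_0 [simp]: "zchar N 0 = 1"
  by (simp add: zchar_def)

lemma zchar_add: "zchar N (k + l) = zchar N k * zchar N l"
  by (simp add: zchar_def exp_add[symmetric] add_divide_distrib diff_divide_distrib distrib_left)

lemma zchar_power: "zchar N (k * int n) = zchar N k ^ n"
  by (induction n) (simp_all add: zchar_add distrib_left mult.commute)

lemma zchar_sum: "zchar N (\<Sum>x\<in>A. f x) = (\<Prod>x\<in>A. zchar N (f x))"
  by (induction A rule: infinite_finite_induct) (auto simp: zchar_add)

lemma zchar_eq_1_iff:
  assumes "N > 0"
  shows "zchar N k = 1 \<longleftrightarrow> int N dvd k"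
proof -
  have "zchar N k = 1 \<longleftrightarrow> (\<exists>n. - (2 * pi * real_of_int k / real N) = real_of_int (2 * n) * pi)"
    by (simp add: zchar_def exp_eq_1)
  also have "\<dots> \<longleftrightarrow> (\<exists>n. pi * real_of_int k = pi * real_of_int (int N * (- n)))"
    using assms by (intro ex_cong1) (auto simp: field_simps)
  also have "\<dots> \<longleftrightarrow> (\<exists>n. k = int N * (- n))"
    by (simp only: of_int_eq_iff mult_left_cancel[OF pi_neq_zero])
  also have "\<dots> \<longleftrightarrow> int N dvd k"
    unfolding dvd_def by (metis minus_minus)
  finally show ?thesis .
qed

lemma zchar_cong:
  assumes "N > 0" "[k = l] (mod int N)"
  shows "zchar N k = zchar N l"
proof -
  have "zchar N (k - l) = 1"
    using assms by (simp add: zchar_eq_1_iff cong_iff_dvd_diff)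
  then show ?thesis
    using zchar_add[of N "k - l" l] by simp
qed

text \<open>A geometric sum whose ratio \<open>zchar N k\<close> is an \<open>N\<close>-th root of
  unity: all terms are 1 if the ratio is 1, and otherwise the closed form has numerator 0.\<close>

lemma sum_zchar:
  assumes "N > 0"
  shows "(\<Sum>m\<in>{0..int N - 1}. zchar N (k * m)) = (if int N dvd k then of_nat N else 0)"
proof -
  have "(\<Sum>m\<in>{0..int N - 1}. zchar N (k * m)) = (\<Sum>n<N. zchar N (k * int n))"
    by (rule sum.reindex_bij_witness[of _ int nat]) auto
  also have "\<dots> = (\<Sum>n<N. zchar N k ^ n)"
    by (simp add: zchar_power)
  also have "\<dots> = (if int N dvd k then of_nat N else 0)"
  proof (cases "int N dvd k")
    case True
    then show ?thesis using assms by (simp flip: zchar_eq_1_iff)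
  next
    case False
    have "zchar N k ^ N = 1"
      using assms by (simp add: zchar_eq_1_iff flip: zchar_power)
    then show ?thesis
      using False assms by (simp add: geometric_sum zchar_eq_1_iff)
  qed
  finally show ?thesis .
qed

text \<open>The character of a dot product factors over the coordinates, so the sum is a product of
  \<open>d\<close> one-dimensional sums. Since \<open>x\<close> may be any integer vector, an
  unreduced difference of two points can be inserted.\<close>

lemma sum_zchar_dot:
  assumes "N > 0"
  shows "(\<Sum>m\<in>ZNd N d. zchar N (dot d x m))
    = (if \<forall>j\<in>{1..d}. int N dvd x j then of_nat N ^ d else 0)"
proof -
  have "(\<Sum>m\<in>ZNd N d. zchar N (dot d x m))
      = (\<Prod>j\<in>{1..d}. \<Sum>k\<in>{0..int N - 1}. zchar N (x j * k))"
    unfolding ZNd_eq dot_def zchar_sum by (rule prod_sum_PiE[symmetric]) auto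
  also have "\<dots> = (if \<forall>j\<in>{1..d}. int N dvd x j then of_nat N ^ d else 0)"
    using assms by (auto simp: sum_zchar)
  finally show ?thesis .
qed

section \<open>Fourier inversion\<close>

lemma dot_commute: "dot d x y = dot d y x"
  by (simp add: dot_def mult.commute)

lemma dot_diff_left: "dot d (\<lambda>j. x j - y j) m = dot d x m - dot d y m"
  by (simp add: dot_def left_diff_distrib sum_subtractf)

lemma dot_mod_left:
  assumes "\<And>j. j \<in> {1..d} \<Longrightarrow> [x j = y j] (mod n)"
  shows "[dot d x m = dot d y m] (mod n)"
  unfolding dot_def by (intro cong_sum cong_mult assms cong_refl)

text \<open>Congruent representatives in \<open>{0..int N - 1}\<close> coincide, and off
  \<open>{1..d}\<close> both points are \<open>undefined\<close> by extensionality.\<close>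

lemma ZNd_eqI:
  assumes "x \<in> ZNd N d" "y \<in> ZNd N d" "\<forall>j\<in>{1..d}. [x j = y j] (mod int N)"
  shows "x = y"
proof (rule PiE_ext)
  show "x \<in> {1..d} \<rightarrow>\<^sub>E {0..int N - 1}" "y \<in> {1..d} \<rightarrow>\<^sub>E {0..int N - 1}"
    using assms by (simp_all add: ZNd_eq)
  fix j assume j: "j \<in> {1..d}"
  then have "x j \<in> {0..int N - 1}" "y j \<in> {0..int N - 1}"
    using assms unfolding ZNd_eq by (blast dest: PiE_mem)+
  then show "x j = y j"
    using assms(3) j by (auto intro: cong_less_imp_eq_int)
qed

lemma fourier_zchar:
  "fourier N d f m = of_real (real N powr (- (real d / 2))) *
     (\<Sum>x\<in>ZNd N d. f x * zchar N (dot d x m))"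
  by (simp add: fourier_def zchar_def)

lemma fourier_inversion:
  assumes N: "N > 0" and x: "x \<in> ZNd N d"
  shows "f x = of_real (real N powr (- (real d / 2))) *
    (\<Sum>m\<in>ZNd N d. fourier N d f m * zchar N (- dot d x m))"
proof -
  define c where "c = complex_of_real (real N powr (- (real d / 2)))"
  \<comment> \<open>The two normalising factors cancel the \<open>N ^ d\<close> that orthogonality
    produces.\<close>
  have "real N powr (- (real d / 2)) * real N powr (- (real d / 2)) * real N ^ d = 1"
    using N by (simp add: powr_add[symmetric] powr_realpow[symmetric])
  then have c: "c * c * of_nat N ^ d = 1"
    unfolding c_def by (metis of_real_1 of_real_mult of_real_of_nat_eq of_real_power)
  have "(\<Sum>m\<in>ZNd N d. fourier N d f m * zchar N (- dot d x m))
      = (\<Sum>m\<in>ZNd N d. \<Sum>y\<in>ZNd N d. c * f y * zchar N (dot d (\<lambda>j. y j - x j) m))"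
    by (simp add: fourier_zchar c_def sum_distrib_left sum_distrib_right dot_diff_left
        mult.assoc flip: zchar_add)
  also have "\<dots> = (\<Sum>y\<in>ZNd N d. c * f y * (\<Sum>m\<in>ZNd N d. zchar N (dot d (\<lambda>j. y j - x j) m)))"
    by (subst sum.swap) (simp add: sum_distrib_left)
  \<comment> \<open>By orthogonality only those \<open>y\<close> survive that agree with
    \<open>x\<close> modulo \<open>N\<close> in each coordinate, that is,
    \<open>y = x\<close>.\<close>
  also have "\<dots> = (\<Sum>y\<in>ZNd N d. if y = x then c * f y * of_nat N ^ d else 0)"
    using ZNd_eqI[OF _ x]
    by (intro sum.cong refl) (auto simp: sum_zchar_dot[OF N] cong_iff_dvd_diff)
  also have "\<dots> = c * f x * of_nat N ^ d"
    using x by simp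
  finally have "c * (\<Sum>m\<in>ZNd N d. fourier N d f m * zchar N (- dot d x m))
      = (c * c * of_nat N ^ d) * f x"
    by (simp only: mult_ac)
  then show ?thesis
    unfolding c by (simp add: c_def)
qed

section \<open>Translations and the reproducing identity\<close>

text \<open>Subtraction in the group; reducing and restricting return the result to the chosen
  representatives.\<close>

definition zdiff :: "nat \<Rightarrow> nat \<Rightarrow> (nat \<Rightarrow> int) \<Rightarrow> (nat \<Rightarrow> int) \<Rightarrow> nat \<Rightarrow> int" where
  "zdiff N d y x = (\<lambda>j\<in>{1..d}. (y j - x j) mod int N)"

lemma zdiff_cong: "j \<in> {1..d} \<Longrightarrow> [zdiff N d y x j = y j - x j] (mod int N)"
  by (simp add: zdiff_def)

lemma zdiff_in_ZNd: "N > 0 \<Longrightarrow> zdiff N d y x \<in> ZNd N d"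
  by (auto simp: ZNd_eq zdiff_def)

lemma bij_betw_zdiff:
  assumes "N > 0"
  shows "bij_betw (\<lambda>y. zdiff N d y x) (ZNd N d) (ZNd N d)"
proof (rule bij_betw_imageI)
  show "inj_on (\<lambda>y. zdiff N d y x) (ZNd N d)"
  proof (rule inj_onI)
    fix y z assume yz: "y \<in> ZNd N d" "z \<in> ZNd N d" and eq: "zdiff N d y x = zdiff N d z x"
    have "[y j = z j] (mod int N)" if "j \<in> {1..d}" for j
    proof -
      have "[y j - x j = zdiff N d y x j] (mod int N)"
        by (rule cong_sym[OF zdiff_cong[OF that]])
      also have "[zdiff N d y x j = z j - x j] (mod int N)"
        unfolding eq by (rule zdiff_cong[OF that])
      finally show ?thesis
        by (simp add: cong_iff_dvd_diff)
    qed
    then show "y = z" using yz by (auto intro: ZNd_eqI)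
  qed
  \<comment> \<open>An injective self-map of a finite set is onto.\<close>
  then show "(\<lambda>y. zdiff N d y x) ` ZNd N d = ZNd N d"
    using assms by (intro endo_inj_surj) (auto simp: zdiff_in_ZNd)
qed

text \<open>Translation permutes the points, and the counting measure does not see this. It makes
  the final bound uniform in \<open>x\<close>.\<close>

lemma Lp_norm_zdiff:
  assumes "N > 0"
  shows "Lp_norm N d p (\<lambda>y. g (zdiff N d y x)) = Lp_norm N d p g"
proof -
  note bij = bij_betw_zdiff[OF assms, of d x]
  have "(\<lambda>y. cmod (g (zdiff N d y x))) ` ZNd N d = (\<lambda>y. cmod (g y)) ` ZNd N d"
    using arg_cong[OF bij_betw_imp_surj_on[OF bij], of "image (\<lambda>y. cmod (g y))"]
    by (simp only: image_image)
  moreover have "(\<Sum>y\<in>ZNd N d. cmod (g (zdiff N d y x)) powr r) = (\<Sum>y\<in>ZNd N d. cmod (g y) powr r)" for r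
    by (rule sum.reindex_bij_betw[OF bij])
  ultimately show ?thesis
    by (simp add: Lp_norm_def)
qed

text \<open>When the transform of \<open>f\<close> is expanded inside the inversion formula and the
  sum over \<open>m\<close> is taken first, that inner sum is the transform of
  \<open>indicator S\<close> at the difference of \<open>y\<close> and \<open>x\<close>.\<close>

lemma reproducing_identity:
  assumes N: "N > 0" and x: "x \<in> ZNd N d" and supp: "supp N d (fourier N d f) \<subseteq> S"
  shows "f x = of_real (real N powr (- (real d / 2))) *
    (\<Sum>y\<in>ZNd N d. f y * fourier N d (indicator S) (zdiff N d y x))"
proof -
  define c where "c = complex_of_real (real N powr (- (real d / 2)))"
  \<comment> \<open>Off \<open>S\<close> the transform of \<open>f\<close> vanishes, so inserting
    the indicator changes no term.\<close>
  have "(\<Sum>m\<in>ZNd N d. fourier N d f m * zchar N (- dot d x m))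
      = (\<Sum>m\<in>ZNd N d. indicator S m * (fourier N d f m * zchar N (- dot d x m)))"
    using supp by (intro sum.cong) (auto simp: supp_def indicator_def)
  also have "\<dots> = (\<Sum>m\<in>ZNd N d. \<Sum>y\<in>ZNd N d.
      f y * (c * (indicator S m * zchar N (dot d y m - dot d x m))))"
    by (simp add: fourier_zchar c_def sum_distrib_left sum_distrib_right mult_ac
        diff_conv_add_uminus zchar_add del: add_uminus_conv_diff)
  also have "\<dots> = (\<Sum>y\<in>ZNd N d. f y * (c * (\<Sum>m\<in>ZNd N d.
      indicator S m * zchar N (dot d m (zdiff N d y x)))))"
  proof (subst sum.swap, unfold sum_distrib_left, intro sum.cong refl)
    fix y m
    \<comment> \<open>Reducing \<open>y - x\<close> to a representative changes the dot product by a
      multiple of \<open>N\<close>, which the character ignores.\<close>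
    have "[dot d y m - dot d x m = dot d m (zdiff N d y x)] (mod int N)"
      unfolding dot_commute[of d m] dot_diff_left[symmetric]
      by (intro dot_mod_left cong_sym[OF zdiff_cong])
    then show "f y * (c * (indicator S m * zchar N (dot d y m - dot d x m)))
        = f y * (c * (indicator S m * zchar N (dot d m (zdiff N d y x))))"
      by (simp only: zchar_cong[OF N])
  qed
  finally show ?thesis
    using fourier_inversion[OF N x, of f] by (simp add: fourier_zchar c_def)
qed

theorem theorem5:
  fixes N d :: nat and p p' :: ennreal
    and S :: "(nat \<Rightarrow> int) set" and f :: "(nat \<Rightarrow> int) \<Rightarrow> complex"
  assumes "1 \<le> N" and "1 \<le> d"
    and "2 \<le> p" and "1 / p + 1 / p' = 1"
    and "S \<subseteq> ZNd N d"
    and "supp N d (fourier N d f) \<subseteq> S"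
  shows "Lp_norm N d \<infinity> f
    \<le> real N powr (- (real d / 2)) * Lp_norm N d p f * Lp_norm N d p' (fourier N d (indicator S))"
proof -
  have N: "N > 0" using assms(1) by simp
  let ?g = "fourier N d (indicator S)"
  let ?c = "real N powr (- (real d / 2))"
  have "cmod (f x) \<le> ?c * Lp_norm N d p f * Lp_norm N d p' ?g" if x: "x \<in> ZNd N d" for x
  proof -
    have "cmod (f x) = ?c * cmod (\<Sum>y\<in>ZNd N d. f y * ?g (zdiff N d y x))"
      using reproducing_identity[OF N x assms(6)]
      by (metis norm_mult norm_of_real abs_of_nonneg powr_ge_zero)
    also have "\<dots> \<le> ?c * (\<Sum>y\<in>ZNd N d. cmod (f y) * cmod (?g (zdiff N d y x)))"
      by (intro mult_left_mono sum_norm_le) (auto simp: norm_mult)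
    also have "\<dots> \<le> ?c * (Lp_norm N d p f * Lp_norm N d p' (\<lambda>y. ?g (zdiff N d y x)))"
      by (intro mult_left_mono Lp_norm_Holder assms(4)) auto
    finally show ?thesis
      by (simp add: Lp_norm_zdiff[OF N] mult.assoc)
  qed
  \<comment> \<open>A pointwise bound passes to \<open>Max\<close> only over a nonempty set.\<close>
  moreover have "ZNd N d \<noteq> {}"
    using zdiff_in_ZNd[OF N] by blast
  ultimately show ?thesis
    by (simp add: Lp_norm_def)
qed

end
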